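(* Let $\gamma:[0,1]\to\mathbb{R}^n$ be continuous and let $I=[0,1]$ with the usual metric. For a finite $K\subset I$, $K=\{k_1<\dots<k_m\}$, let $s(K)=\sum_{i=1}^{m-1}\|\gamma(k_{i+1})-\gamma(k_i)\|$ be the length of the inscribed polygon determined by $K$. Then the following two definitions of the arc length of $\gamma$ are equivalent, i.e. for every $A\in\mathbb{R}\cup\{+\infty\}$ the arc length is $A$ in the first sense if and only if it is $A$ in the second sense: (1) $A=\sup\{s(K): K\subset I\text{ finite}\}$; (2) if $A\in\mathbb{R}$: for every $\epsilon>0$ there is $\delta>0$ such that for every finite $K\subset I$ with $d_H(K,I)<\delta$ we have $|s(K)-A|<\epsilon$; if $A=+\infty$: for every $r\in\mathbb{N}$ there is $\delta>0$ such that for every finite $K\subset I$ with $d_H(K,I)<\delta$ we have $s(K)>r$.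
   Context: $\|\cdot\|$ is the Euclidean norm. For a metric space $(I,d)$, $A\subset I$ and $\epsilon>0$, let $S(A,\epsilon)=\bigcup_{x\in A}\{y\in I: d(x,y)<\epsilon\}$. The Hausdorff pseudo-metric on subsets of $I$ is $d_H(A,C)=\inf\{\epsilon>0: A\subset S(C,\epsilon),\ C\subset S(A,\epsilon)\}$ (with $\inf\emptyset=+\infty$). *)

theory Defs
  imports "HOL-Analysis.Analysis"
begin

text \<open>The metric space is the subset \<open>I\<close> of the ambient type with the restricted distance, so
  neighbourhoods are taken inside \<open>I\<close>.\<close>

definition nbhd_in :: "'a::metric_space set \<Rightarrow> 'a set \<Rightarrow> real \<Rightarrow> 'a set" where
  "nbhd_in I A \<epsilon> = (\<Union>x\<in>A. {y \<in> I. dist x y < \<epsilon>})"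

text \<open>Values lie in \<^typ>\<open>ereal\<close>, where the infimum of the empty set is \<open>\<infinity>\<close>.\<close>

definition hausdorff_pdist :: "'a::metric_space set \<Rightarrow> 'a set \<Rightarrow> 'a set \<Rightarrow> ereal" where
  "hausdorff_pdist I A C =
     Inf {ereal \<epsilon> | \<epsilon>. \<epsilon> > 0 \<and> A \<subseteq> nbhd_in I C \<epsilon> \<and> C \<subseteq> nbhd_in I A \<epsilon>}"

text \<open>Only meaningful for finite \<open>K\<close>. List positions start at 0, and the sum is empty if
  \<open>K\<close> has at most one point.\<close>

definition polygon_length :: "(real \<Rightarrow> 'a::real_normed_vector) \<Rightarrow> real set \<Rightarrow> real" where
  "polygon_length \<gamma> K =
     (let k = sorted_list_of_set K in
        \<Sum>i<card K - 1. norm (\<gamma> (k ! Suc i) - \<gamma> (k ! i)))"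

definition arc_length_sup :: "(real \<Rightarrow> 'a::real_normed_vector) \<Rightarrow> ereal \<Rightarrow> bool" where
  "arc_length_sup \<gamma> A \<longleftrightarrow>
     A = (SUP K\<in>{K. finite K \<and> K \<subseteq> {0..1}}. ereal (polygon_length \<gamma> K))"

definition arc_length_lim :: "(real \<Rightarrow> 'a::real_normed_vector) \<Rightarrow> ereal \<Rightarrow> bool" where
  "arc_length_lim \<gamma> A \<longleftrightarrow> (case A of
     ereal a \<Rightarrow>
       \<forall>\<epsilon>>0. \<exists>\<delta>>0. \<forall>K. finite K \<and> K \<subseteq> {0..1} \<and> hausdorff_pdist {0..1} K {0..1} < ereal \<delta>
         \<longrightarrow> \<bar>polygon_length \<gamma> K - a\<bar> < \<epsilon>
   | PInfty \<Rightarrow>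
       \<forall>r::nat. \<exists>\<delta>>0. \<forall>K. finite K \<and> K \<subseteq> {0..1} \<and> hausdorff_pdist {0..1} K {0..1} < ereal \<delta>
         \<longrightarrow> polygon_length \<gamma> K > real r
   | MInfty \<Rightarrow> False)"

end

(* Adding a vertex p to a partition K never shortens the inscribed polygon, and lengthens it by at
   most 2 \<eta> when gamma varies by at most \<eta> between p and the points of K near p. Hence, if P is a
   fixed finite set and K is fine, s(P) \<le> s(K \<union> P) \<le> s(K) + 2 card(P) \<eta>, so s(K) is
   eventually almost as large as s(P). This shows that the supremum is the limit; the equivalence
   follows because limits along ever finer partitions are unique. *)

theory Submission
  imports Defs
begin

text \<open>Recursion along the vertices replaces the indexed sum, so that adding a point to a
  vertex set becomes \<open>insort\<close> and can be treated by induction.\<close>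

fun list_length :: "(real \<Rightarrow> 'a::real_normed_vector) \<Rightarrow> real list \<Rightarrow> real" where
  "list_length \<gamma> (x # y # zs) = norm (\<gamma> y - \<gamma> x) + list_length \<gamma> (y # zs)"
| "list_length \<gamma> _ = 0"

lemma list_length_eq_sum:
  "list_length \<gamma> xs = (\<Sum>i<length xs - 1. norm (\<gamma> (xs ! Suc i) - \<gamma> (xs ! i)))"
  by (induction \<gamma> xs rule: list_length.induct)
     (auto simp: sum.lessThan_Suc_shift simp del: sum.lessThan_Suc)

lemma polygon_length_eq_list_length:
  "polygon_length \<gamma> K = list_length \<gamma> (sorted_list_of_set K)"
  by (simp add: polygon_length_def list_length_eq_sum Let_def)

lemma list_length_le_insort: "list_length \<gamma> xs \<le> list_length \<gamma> (insort p xs)"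
proof (induction \<gamma> xs rule: list_length.induct)
  case (1 \<gamma> x y zs)
  have "norm (\<gamma> y - \<gamma> x) \<le> norm (\<gamma> p - \<gamma> x) + norm (\<gamma> y - \<gamma> p)"
    using norm_triangle_ineq[of "\<gamma> p - \<gamma> x" "\<gamma> y - \<gamma> p"] by simp
  with 1 show ?case by auto
qed auto

text \<open>Between neighbours x and y the edge xy is replaced by xp and py, which by the triangle
  inequality costs at most twice the distance from \<open>\<gamma> p\<close> to either endpoint's
  image. Sortedness guarantees that some neighbour of p is at least as close to p as the given
  k.\<close>

lemma list_length_insort_le:
  assumes "sorted xs" "k \<in> set xs" "\<bar>k - p\<bar> < \<delta>"
    and "\<And>x. x \<in> set xs \<Longrightarrow> \<bar>x - p\<bar> < \<delta> \<Longrightarrow> norm (\<gamma> x - \<gamma> p) \<le> \<eta>"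
  shows "list_length \<gamma> (insort p xs) \<le> list_length \<gamma> xs + 2 * \<eta>"
  using assms
proof (induction \<gamma> xs arbitrary: k rule: list_length.induct)
  case (1 \<gamma> x y zs)
  have tri1: "norm (\<gamma> y - \<gamma> p) \<le> norm (\<gamma> y - \<gamma> x) + norm (\<gamma> x - \<gamma> p)"
    using norm_triangle_ineq[of "\<gamma> y - \<gamma> x" "\<gamma> x - \<gamma> p"] by simp
  have tri2: "norm (\<gamma> p - \<gamma> x) \<le> norm (\<gamma> y - \<gamma> x) + norm (\<gamma> y - \<gamma> p)"
    using norm_triangle_ineq4[of "\<gamma> y - \<gamma> x" "\<gamma> y - \<gamma> p"] by simp
  have sym: "norm (\<gamma> p - \<gamma> x) = norm (\<gamma> x - \<gamma> p)"
    by (rule norm_minus_commute)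
  have order: "x \<le> y" "\<forall>z\<in>set zs. y \<le> z" "sorted (y # zs)"
    using "1.prems"(1) by auto
  consider "p \<le> x" | "x < p" "p \<le> y" | "y < p"
    by linarith
  then show ?case
  proof cases
    case 1
    \<comment> \<open>Here p \<le> x \<le> k, so x inherits the closeness of k. Only one edge is
      added, and \<open>0 \<le> \<eta>\<close> turns its bound \<eta> into 2 \<eta>.\<close>
    with order "1.prems"(2,3) have "\<bar>x - p\<bar> < \<delta>" by fastforce
    then have n: "norm (\<gamma> x - \<gamma> p) \<le> \<eta>" using "1.prems"(4) by simp
    then have "0 \<le> \<eta>" using norm_ge_zero order_trans by blast
    with n 1 show ?thesis by simp
  next
    case 2
    \<comment> \<open>Either k = x or y \<le> k, so the endpoint on the same side of p as k is close
      to p.\<close>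
    with order "1.prems"(2,3) have "\<bar>x - p\<bar> < \<delta> \<or> \<bar>y - p\<bar> < \<delta>" by fastforce
    then have "norm (\<gamma> x - \<gamma> p) \<le> \<eta> \<or> norm (\<gamma> y - \<gamma> p) \<le> \<eta>"
      using "1.prems"(4) by auto
    \<comment> \<open>If x is the close endpoint, \<open>tri1\<close> bounds the edge from p to y;
      if y is, \<open>tri2\<close> bounds the edge from x to p.\<close>
    then have "norm (\<gamma> p - \<gamma> x) + norm (\<gamma> y - \<gamma> p) \<le> norm (\<gamma> y - \<gamma> x) + 2 * \<eta>"
      using tri1 tri2 sym by linarith
    with 2 show ?thesis by simp
  next
    case 3
    \<comment> \<open>The induction hypothesis needs a close point in the tail. If k is the head x,
      then x \<le> y < p and y takes its place.\<close>
    have "\<exists>j\<in>set (y # zs). \<bar>j - p\<bar> < \<delta>"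
    proof (cases "k = x")
      case True
      with 3 order(1) "1.prems"(3) have "\<bar>y - p\<bar> < \<delta>" by linarith
      then show ?thesis by simp
    qed (use "1.prems"(2,3) in auto)
    then obtain j where "j \<in> set (y # zs)" "\<bar>j - p\<bar> < \<delta>" by blast
    then have "list_length \<gamma> (insort p (y # zs)) \<le> list_length \<gamma> (y # zs) + 2 * \<eta>"
      using "1.IH" order(3) "1.prems"(4) by simp
    with 3 order(1) show ?thesis by simp
  qed
next
  case ("2_2" \<gamma> x)
  then have n: "norm (\<gamma> x - \<gamma> p) \<le> \<eta>" by simp
  then have "0 \<le> \<eta>" using norm_ge_zero order_trans by blast
  with n show ?case by (simp add: norm_minus_commute)
qed simp

lemma polygon_length_le_insert:
  assumes "finite K"
  shows "polygon_length \<gamma> K \<le> polygon_length \<gamma> (insert p K)"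
proof (cases "p \<in> K")
  case False
  with assms show ?thesis
    by (simp add: polygon_length_eq_list_length list_length_le_insort)
qed (simp add: insert_absorb)

lemma polygon_length_le_Un:
  assumes "finite K" "finite P"
  shows "polygon_length \<gamma> P \<le> polygon_length \<gamma> (K \<union> P)"
  using assms(1)
proof (induction rule: finite_induct)
  case (insert x K)
  with assms(2) show ?case
    using polygon_length_le_insert[of "K \<union> P" \<gamma> x] by simp
qed simp

lemma polygon_length_insert_le:
  assumes "finite K" "k \<in> K" "\<bar>k - p\<bar> < \<delta>"
    and near: "\<And>x. x \<in> K \<Longrightarrow> \<bar>x - p\<bar> < \<delta> \<Longrightarrow> norm (\<gamma> x - \<gamma> p) \<le> \<eta>"
  shows "polygon_length \<gamma> (insert p K) \<le> polygon_length \<gamma> K + 2 * \<eta>"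
proof (cases "p \<in> K")
  case True
  have "0 \<le> \<eta>" using near[OF assms(2,3)] norm_ge_zero order_trans by blast
  with True show ?thesis by (simp add: insert_absorb)
next
  case False
  then show ?thesis
    using assms list_length_insort_le[of "sorted_list_of_set K" k p \<delta> \<gamma> \<eta>]
    by (simp add: polygon_length_eq_list_length)
qed

text \<open>The points of P are inserted one at a time, each at a cost of at most 2 \<eta>. K alone
  always supplies the close vertex, while the bound on the variation over all of S also covers the
  points of P inserted earlier.\<close>

lemma polygon_length_Un_le:
  assumes "finite P" "finite K" "K \<subseteq> S" "P \<subseteq> S"
    and dense: "\<And>p. p \<in> P \<Longrightarrow> \<exists>k\<in>K. \<bar>k - p\<bar> < \<delta>"
    and var: "\<And>x y. x \<in> S \<Longrightarrow> y \<in> S \<Longrightarrow> \<bar>x - y\<bar> < \<delta> \<Longrightarrow> norm (\<gamma> x - \<gamma> y) \<le> \<eta>"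
  shows "polygon_length \<gamma> (K \<union> P) \<le> polygon_length \<gamma> K + 2 * real (card P) * \<eta>"
  using assms(1,4) dense
proof (induction rule: finite_induct)
  case (insert p P)
  obtain k where k: "k \<in> K" "\<bar>k - p\<bar> < \<delta>" using insert.prems(2) by blast
  have "polygon_length \<gamma> (insert p (K \<union> P)) \<le> polygon_length \<gamma> (K \<union> P) + 2 * \<eta>"
  proof (rule polygon_length_insert_le[where k = k and \<delta> = \<delta>])
    show "norm (\<gamma> x - \<gamma> p) \<le> \<eta>" if "x \<in> K \<union> P" "\<bar>x - p\<bar> < \<delta>" for x
      using that insert.prems(1) assms(3) by (intro var) auto
  qed (use k insert.hyps assms(2) in auto)
  with insert show ?case by (simp add: algebra_simps)
qed simp

lemma hausdorff_pdist_lessD: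
  assumes "hausdorff_pdist I K C < ereal \<delta>" "x \<in> C"
  shows "\<exists>k\<in>K. dist k x < \<delta>"
proof -
  \<comment> \<open>The infimum need not be attained, but the strict bound yields an admissible
    \<epsilon> below \<delta>.\<close>
  obtain \<epsilon> where "\<epsilon> < \<delta>" "C \<subseteq> nbhd_in I K \<epsilon>"
    using assms(1) unfolding hausdorff_pdist_def Inf_less_iff by auto
  then obtain k where "k \<in> K" "dist k x < \<epsilon>"
    using assms(2) by (auto simp: nbhd_in_def)
  with \<open>\<epsilon> < \<delta>\<close> have "dist k x < \<delta>" by linarith
  with \<open>k \<in> K\<close> show ?thesis ..
qed

lemma compact_finite_hausdorff_approx:
  assumes "compact I" "\<delta> > 0"
  obtains K where "finite K" "K \<subseteq> I" "hausdorff_pdist I K I < ereal \<delta>"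
proof -
  \<comment> \<open>An admissible radius only bounds the infimum weakly; halving \<delta> makes the
    final inequality strict.\<close>
  have "\<delta> / 2 > 0" using assms(2) by simp
  then have "\<exists>K. finite K \<and> K \<subseteq> I \<and> I \<subseteq> (\<Union>x\<in>K. ball x (\<delta> / 2))"
    using seq_compact_imp_totally_bounded[OF compact_imp_seq_compact[OF assms(1)]] by simp
  then obtain K where K: "finite K" "K \<subseteq> I" "I \<subseteq> (\<Union>x\<in>K. ball x (\<delta> / 2))"
    by (elim exE conjE)
  have "I \<subseteq> nbhd_in I K (\<delta> / 2)" using K(3) by (fastforce simp: nbhd_in_def)
  moreover have "K \<subseteq> nbhd_in I I (\<delta> / 2)"
    using K(2) \<open>\<delta> / 2 > 0\<close> by (force simp: nbhd_in_def)
  ultimately have "hausdorff_pdist I K I \<le> ereal (\<delta> / 2)"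
    unfolding hausdorff_pdist_def using \<open>\<delta> / 2 > 0\<close> by (intro Inf_lower) blast
  also have "\<dots> < ereal \<delta>" using assms(2) by simp
  finally show thesis using that K by blast
qed

text \<open>With the quantifiers over \<delta> and K packed into a filter, the second notion of arc
  length becomes an ordinary limit.\<close>

definition fine_vertex_sets :: "real set filter" where
  "fine_vertex_sets = (INF \<delta>\<in>{0<..}.
     principal {K. finite K \<and> K \<subseteq> {0..1} \<and> hausdorff_pdist {0..1} K {0..1} < ereal \<delta>})"

lemma eventually_fine_vertex_sets:
  "eventually P fine_vertex_sets \<longleftrightarrow>
    (\<exists>\<delta>>0. \<forall>K. finite K \<and> K \<subseteq> {0..1} \<and> hausdorff_pdist {0..1} K {0..1} < ereal \<delta> \<longrightarrow> P K)"
proof -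
  let ?N = "\<lambda>\<delta>::real. {K::real set.
    finite K \<and> K \<subseteq> {0..1} \<and> hausdorff_pdist {0..1} K {0..1} < ereal \<delta>}"
  have mono: "?N \<delta> \<subseteq> ?N \<delta>'" if "\<delta> \<le> \<delta>'" for \<delta> \<delta>'
    using that by (auto elim!: less_le_trans)
  have "eventually P fine_vertex_sets \<longleftrightarrow> (\<exists>\<delta>\<in>{0<..}. eventually P (principal (?N \<delta>)))"
    unfolding fine_vertex_sets_def
  proof (rule eventually_INF_base)
    fix a b :: real
    assume "a \<in> {0<..}" "b \<in> {0<..}"
    then have min: "min a b \<in> {0<..}" by simp
    \<comment> \<open>The sets \<open>?N \<delta>\<close> are nested, hence form a filter base, and
      a single \<delta> witnesses each eventual property.\<close>
    have "principal (?N (min a b)) \<le> inf (principal (?N a)) (principal (?N b))"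
      unfolding inf_principal principal_le_iff using mono[of "min a b" a] mono[of "min a b" b]
      by (intro Int_greatest) simp_all
    then show "\<exists>x\<in>{0<..}. principal (?N x) \<le> inf (principal (?N a)) (principal (?N b))"
      using min by (rule bexI)
  qed (use zero_less_one in blast)
  then show ?thesis by (simp add: eventually_principal Bex_def)
qed

text \<open>Total boundedness of the unit interval makes the filter proper, as uniqueness of limits
  requires.\<close>

lemma fine_vertex_sets_neq_bot: "fine_vertex_sets \<noteq> bot"
proof -
  have "\<exists>K\<subseteq>{0..1::real}. finite K \<and> hausdorff_pdist {0..1} K {0..1} < ereal \<delta>"
    if pos: "\<delta> > 0" for \<delta>
  proof -
    obtain K :: "real set" where
      "finite K" "K \<subseteq> {0..1}" "hausdorff_pdist {0..1} K {0..1} < ereal \<delta>"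
      by (rule compact_finite_hausdorff_approx[OF compact_Icc pos])
    then show ?thesis by (intro exI[of _ K] conjI)
  qed
  then have "\<not> eventually (\<lambda>K. False) fine_vertex_sets"
    by (simp add: eventually_fine_vertex_sets)
  then show ?thesis by (simp add: trivial_limit_def)
qed

lemma arc_length_lim_iff_tendsto:
  assumes "A \<noteq> -\<infinity>"
  shows "arc_length_lim \<gamma> A \<longleftrightarrow> ((\<lambda>K. ereal (polygon_length \<gamma> K)) \<longlongrightarrow> A) fine_vertex_sets"
proof (cases A)
  case (real a)
  then show ?thesis
    by (simp add: arc_length_lim_def tendsto_iff dist_real_def eventually_fine_vertex_sets)
next
  case PInf
  \<comment> \<open>The definition uses natural thresholds and convergence to \<infinity> real ones;
    the Archimedean property reconciles them.\<close>
  have "(\<forall>n::nat. \<forall>\<^sub>F K in fine_vertex_sets. real n < polygon_length \<gamma> K) \<longleftrightarrow>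
      (\<forall>r. \<forall>\<^sub>F K in fine_vertex_sets. r < polygon_length \<gamma> K)" (is "?L \<longleftrightarrow> ?R")
  proof
    assume L: ?L
    show ?R
    proof
      fix r
      obtain n :: nat where "r < real n" using reals_Archimedean2 by blast
      with L[rule_format, of n] show "\<forall>\<^sub>F K in fine_vertex_sets. r < polygon_length \<gamma> K"
        by (auto elim: eventually_mono)
    qed
  qed blast
  then show ?thesis
    by (simp add: PInf arc_length_lim_def tendsto_PInfty eventually_fine_vertex_sets)
qed (use assms in simp)

lemma eventually_polygon_length_gt:
  assumes cont: "continuous_on {0..1} \<gamma>"
    and P: "finite P" "P \<subseteq> {0..1}" and c: "c < polygon_length \<gamma> P"
  shows "\<forall>\<^sub>F K in fine_vertex_sets. c < polygon_length \<gamma> K"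
proof -
  \<comment> \<open>With this \<eta>, the total loss 2 card(P) \<eta> plus one spare \<eta> equals
    the gap between s(P) and c. The spare \<eta> makes the final inequality strict and keeps the
    denominator positive when P is empty.\<close>
  define \<eta> where "\<eta> = (polygon_length \<gamma> P - c) / (2 * real (card P) + 1)"
  have "\<eta> > 0" using c by (simp add: \<eta>_def)
  have "(2 * real (card P) + 1) * \<eta> = polygon_length \<gamma> P - c"
    unfolding \<eta>_def by simp
  then have \<eta>: "2 * real (card P) * \<eta> + \<eta> = polygon_length \<gamma> P - c"
    by (simp add: distrib_right)
  \<comment> \<open>Uniform continuity provides one \<delta> that serves all points of P and all K
    at once.\<close>
  have "uniformly_continuous_on {0..1} \<gamma>"
    using cont compact_uniformly_continuous compact_Icc by blast
  then obtain \<delta> where \<delta>: "\<delta> > 0"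
    "\<And>x y. x \<in> {0..1} \<Longrightarrow> y \<in> {0..1} \<Longrightarrow> \<bar>x - y\<bar> < \<delta> \<Longrightarrow> norm (\<gamma> x - \<gamma> y) \<le> \<eta>"
    using \<open>\<eta> > 0\<close> unfolding uniformly_continuous_on_def dist_norm real_norm_def
    by (metis less_imp_le)
  have "c < polygon_length \<gamma> K"
    if K: "finite K" "K \<subseteq> {0..1}" "hausdorff_pdist {0..1} K {0..1} < ereal \<delta>" for K
  proof -
    have "polygon_length \<gamma> P \<le> polygon_length \<gamma> (K \<union> P)"
      using K(1) P(1) by (rule polygon_length_le_Un)
    also have "\<dots> \<le> polygon_length \<gamma> K + 2 * real (card P) * \<eta>"
      using P K(1,2) hausdorff_pdist_lessD[OF K(3)] \<delta>(2)
      by (intro polygon_length_Un_le[where S = "{0..1}" and \<delta> = \<delta>])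
         (auto simp: dist_real_def)
    finally show ?thesis using \<eta> \<open>\<eta> > 0\<close> by linarith
  qed
  with \<delta>(1) show ?thesis unfolding eventually_fine_vertex_sets by blast
qed

lemma polygon_length_tendsto_SUP:
  assumes cont: "continuous_on {0..1} \<gamma>"
  shows "((\<lambda>K. ereal (polygon_length \<gamma> K)) \<longlongrightarrow>
    (SUP K\<in>{K. finite K \<and> K \<subseteq> {0..1}}. ereal (polygon_length \<gamma> K))) fine_vertex_sets"
    (is "(_ \<longlongrightarrow> ?A) _")
proof (rule order_tendstoI)
  fix c assume "c < ?A"
  then obtain P where P: "finite P" "P \<subseteq> {0..1}" "c < ereal (polygon_length \<gamma> P)"
    unfolding less_SUP_iff by blast
  show "\<forall>\<^sub>F K in fine_vertex_sets. c < ereal (polygon_length \<gamma> K)"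
    \<comment> \<open>For c = -\<infinity> the claim is trivial, and c = \<infinity> contradicts the
      choice of P.\<close>
    using P eventually_polygon_length_gt[OF cont P(1,2)] by (cases c) auto
next
  fix c assume c: "?A < c"
  have "ereal (polygon_length \<gamma> K) < c" if "finite K" "K \<subseteq> {0..1}" for K
    using that by (intro le_less_trans[OF _ c] SUP_upper) simp
  \<comment> \<open>The supremum bounds every K regardless of fineness, so \<delta> = 1 will
    do.\<close>
  then show "\<forall>\<^sub>F K in fine_vertex_sets. ereal (polygon_length \<gamma> K) < c"
    unfolding eventually_fine_vertex_sets using zero_less_one by blast
qed

theorem corollary5p33:
  fixes \<gamma> :: "real \<Rightarrow> real ^ 'n" and A :: ereal
  assumes "continuous_on {0..1} \<gamma>"
    and "A \<noteq> -\<infinity>"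
  shows "arc_length_sup \<gamma> A \<longleftrightarrow> arc_length_lim \<gamma> A"
  unfolding arc_length_sup_def arc_length_lim_iff_tendsto[OF assms(2)]
  \<comment> \<open>The supremum is a limit; conversely any limit A equals it, since limits in
    \<open>ereal\<close> along a proper filter are unique.\<close>
  using polygon_length_tendsto_SUP[OF assms(1)] tendsto_unique[OF fine_vertex_sets_neq_bot]
  by blast

end
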